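(* Let $r\geq 4$, let $\mathfrak{g}=\mathfrak{so}_{2r}(\mathbb{C})$ be the simple Lie algebra of type $D_r$, and let $\tilde{\alpha}=\alpha_1+\cdots+\alpha_r$ be the sum of its simple roots. Then $|\mathcal{A}_r(\tilde{\alpha},0)|=\tilde{F}_{r-3}$.
   Context: Let $W$ be the Weyl group, generated by the simple reflections $s_1,\dots,s_r$, and $\rho$ half the sum of the positive roots. The simple roots of type $D_r$ are numbered so that $\alpha_1,\dots,\alpha_{r-2}$ form a chain in the Dynkin diagram and $\alpha_{r-2}$ is adjacent to both $\alpha_{r-1}$ and $\alpha_r$. Kostant's partition function $\wp(\xi)$ is the number of ways to write $\xi\in\mathfrak{h}^*$ as a nonnegative integral sum of positive roots. The Weyl alternation set of integral weights $\lambda,\mu$ is $\mathcal{A}(\lambda,\mu)=\{\sigma\in W:\wp(\sigma(\lambda+\rho)-(\mu+\rho))>0\}$, written $\mathcal{A}_r(\lambda,\mu)$ to indicate the rank $r$. The sequence $\tilde{F}_n$ ($n\ge1$) is defined by $\tilde F_1=2$, $\tilde F_2=6$ and $\tilde{F}_n=\tilde{F}_{n-1}+\tilde{F}_{n-2}$ for $n\ge 3$. *)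

theory Defs
  imports "Jordan_Normal_Form.Matrix" "HOL-Library.Multiset" "HOL-Library.Function_Algebras"
begin

section \<open>The Lie algebra of type D and its roots\<close>

text \<open>
  The Lie algebra so(2r, C) is taken with respect to the split symmetric bilinear form, whose Gram
  matrix has zero diagonal blocks and identity off-diagonal blocks of size r, so that its diagonal
  matrices diag(h1, ..., hr, -h1, ..., -hr) form a Cartan subalgebra.
\<close>

definition split_form :: "nat \<Rightarrow> complex mat" where
  "split_form r = four_block_mat (0\<^sub>m r r) (1\<^sub>m r) (1\<^sub>m r) (0\<^sub>m r r)"

definition so_even :: "nat \<Rightarrow> complex mat set" where
  "so_even r = {X \<in> carrier_mat (2 * r) (2 * r).
     transpose_mat X * split_form r + split_form r * X = 0\<^sub>m (2 * r) (2 * r)}"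

definition cartan :: "nat \<Rightarrow> complex mat set" where
  "cartan r = {H \<in> so_even r. diagonal_mat H}"

text \<open>
  An element a of the dual of the Cartan subalgebra is given by its coordinates a 1, ..., a r, all
  other coordinates being 0; it maps diag(h1, ..., hr, -h1, ..., -hr) to a 1 * h1 + ... + a r * hr.
  Matrix indices start at 0. The vector space operations are the pointwise ones.
\<close>

type_synonym weight = "nat \<Rightarrow> complex"

definition cartan_dual :: "nat \<Rightarrow> weight set" where
  "cartan_dual r = {a. \<forall>k. k \<notin> {1..r} \<longrightarrow> a k = 0}"

definition weight_eval :: "nat \<Rightarrow> weight \<Rightarrow> complex mat \<Rightarrow> complex" where
  "weight_eval r a H = (\<Sum>k = 1..r. a k * H $$ (k - 1, k - 1))"

definition roots :: "nat \<Rightarrow> weight set" where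
  "roots r = {a \<in> cartan_dual r. a \<noteq> 0 \<and>
     (\<exists>X \<in> so_even r. X \<noteq> 0\<^sub>m (2 * r) (2 * r) \<and>
        (\<forall>H \<in> cartan r. H * X - X * H = weight_eval r a H \<cdot>\<^sub>m X))}"

definition eps :: "nat \<Rightarrow> weight" where
  "eps i = (\<lambda>k. if k = i then 1 else 0)"

definition simple_root :: "nat \<Rightarrow> nat \<Rightarrow> weight" where
  "simple_root r i = (if i < r then eps i - eps (i + 1) else eps (r - 1) + eps r)"

definition positive_roots :: "nat \<Rightarrow> weight set" where
  "positive_roots r =
     {a \<in> roots r. \<exists>M. set_mset M \<subseteq> simple_root r ` {1..r} \<and> a = \<Sum>\<^sub># M}"

definition rho :: "nat \<Rightarrow> weight" where
  "rho r = (\<lambda>k. (\<Sum>\<beta> \<in> positive_roots r. \<beta> k) / 2)"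

section \<open>The Weyl group\<close>

text \<open>
  The form below is, on the Cartan dual, a scalar multiple of the form induced by the Killing form,
  so it defines the same reflections.
\<close>

definition weight_form :: "nat \<Rightarrow> weight \<Rightarrow> weight \<Rightarrow> complex" where
  "weight_form r a b = (\<Sum>k = 1..r. a k * b k)"

definition simple_reflection :: "nat \<Rightarrow> nat \<Rightarrow> weight \<Rightarrow> weight" where
  "simple_reflection r i v =
     v - (\<lambda>k. 2 * weight_form r v (simple_root r i)
              / weight_form r (simple_root r i) (simple_root r i) * simple_root r i k)"

text \<open>
  The simple reflections are involutions, so the generated monoid is the generated group. Its
  elements are functions on all of \<^typ>\<open>weight\<close>; they leave the coordinates outside 1, ..., r alone,
  hence are determined by their restrictions to the Cartan dual.
\<close>

inductive_set weyl_group :: "nat \<Rightarrow> (weight \<Rightarrow> weight) set" for r where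
  id: "id \<in> weyl_group r"
| refl: "i \<in> {1..r} \<Longrightarrow> w \<in> weyl_group r \<Longrightarrow> simple_reflection r i \<circ> w \<in> weyl_group r"

section \<open>Weyl alternation sets\<close>

text \<open>
  The set counted here is finite, because the positive roots are finitely many and lie in an open
  half-space; thus \<^const>\<open>card\<close> does not degenerate.
\<close>

definition kostant_partition :: "nat \<Rightarrow> weight \<Rightarrow> nat" where
  "kostant_partition r \<xi> = card {M. set_mset M \<subseteq> positive_roots r \<and> \<Sum>\<^sub># M = \<xi>}"

definition weyl_alternation_set :: "nat \<Rightarrow> weight \<Rightarrow> weight \<Rightarrow> (weight \<Rightarrow> weight) set" where
  "weyl_alternation_set r l m =
     {\<sigma> \<in> weyl_group r. kostant_partition r (\<sigma> (l + rho r) - (m + rho r)) > 0}"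

text \<open>The sequence starts at index 1; the value at 0 is arbitrary.\<close>

fun fib_tilde :: "nat \<Rightarrow> nat" where
  "fib_tilde 0 = 0"
| "fib_tilde (Suc 0) = 2"
| "fib_tilde (Suc (Suc 0)) = 6"
| "fib_tilde (Suc (Suc (Suc n))) = fib_tilde (Suc (Suc n)) + fib_tilde (Suc n)"

end

theory Submission
  imports Defs "HOL-Combinatorics.Permutations" "HOL-Combinatorics.Multiset_Permutations"
begin

text \<open>
  In coordinates, rho = (r - 1, ..., 1, 0), and the sum of the simple roots is eps 1 +
  eps (r - 1), so the shifted weight is (r, r - 2, r - 3, ..., 3, 2, 2, 0). The Weyl group acts by
  permutations of the coordinates combined with an even number of sign changes, and a difference
  v - rho has a positive partition number if and only if it is a nonnegative integral combination
  of simple roots.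

  If v is an image of the shifted weight and v - rho is such a combination, then the coordinates
  of v - rho have a nonnegative total. Without sign changes the total is 2; changing the sign of a
  nonzero coordinate, which is at least 2, lowers it by at least 4. So no nonzero coordinate
  changes sign, and by parity the sign of the coordinate 0 is not changed either. Nonnegativity of
  the coefficient of the simple root with index r - 1 then forces 0 into the last position, and
  the remaining coefficients are nonnegative exactly when the partial sums of v dominate those of
  rho (\<open>signed_permutation_dominating\<close>, \<open>dominating_in_span\<close>). Hence the
  alternation set is in bijection with the permutations that satisfy this domination. The two
  coordinates of value 2 are distinguished here: the stabilizer of the shifted weight has order 2.

  The first coordinate has to be r, which leaves an excess of 1 over rho. The positions 2, ...,
  r - 1 have to be filled with n = r - 2 coordinates n, n - 1, ..., 2, 2 against n, ..., 1. For n
  at least 4 one either starts with n, or with n - 1 followed by n, and in both cases the excess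
  is 1 again (\<open>dominating_orderings_rec\<close>). This is the Fibonacci recursion, and for n
  = 2 and n = 3 all 2 and 6 orderings occur.
\<close>

section \<open>The matrices of the orthogonal Lie algebra\<close>

text \<open>
  The form pairs the standard basis vector with index i and the one with index opp r i, where the
  indices are 0, ..., 2r - 1.
\<close>

definition opp :: "nat \<Rightarrow> nat \<Rightarrow> nat" where
  "opp r i = (if i < r then i + r else i - r)"

lemma opp_less: "i < 2 * r \<Longrightarrow> opp r i < 2 * r"
  by (auto simp: opp_def)

lemma opp_opp: "i < 2 * r \<Longrightarrow> opp r (opp r i) = i"
  by (auto simp: opp_def)

lemma dim_split_form [simp]: "dim_row (split_form r) = 2 * r" "dim_col (split_form r) = 2 * r"
  by (simp_all add: split_form_def mult_2)

lemma split_form_index: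
  assumes "i < 2 * r" "j < 2 * r"
  shows "split_form r $$ (i, j) = (if j = opp r i then 1 else 0)"
  using assms by (auto simp: split_form_def opp_def)

lemma split_form_left:
  assumes "X \<in> carrier_mat (2 * r) (2 * r)" "i < 2 * r" "j < 2 * r"
  shows "(split_form r * X) $$ (i, j) = X $$ (opp r i, j)"
proof -
  have "(split_form r * X) $$ (i, j) = (\<Sum>k = 0..<2 * r. split_form r $$ (i, k) * X $$ (k, j))"
    using assms by (auto simp: scalar_prod_def)
  also have "\<dots> = (\<Sum>k = 0..<2 * r. if k = opp r i then X $$ (k, j) else 0)"
    using assms by (intro sum.cong) (auto simp: split_form_index)
  also have "\<dots> = X $$ (opp r i, j)"
    using opp_less[OF assms(2)] by simp
  finally show ?thesis .
qed

lemma split_form_right: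
  assumes "X \<in> carrier_mat (2 * r) (2 * r)" "i < 2 * r" "j < 2 * r"
  shows "(transpose_mat X * split_form r) $$ (i, j) = X $$ (opp r j, i)"
proof -
  have "(transpose_mat X * split_form r) $$ (i, j)
      = (\<Sum>k = 0..<2 * r. X $$ (k, i) * split_form r $$ (k, j))"
    using assms by (auto simp: scalar_prod_def)
  also have "\<dots> = (\<Sum>k = 0..<2 * r. if k = opp r j then X $$ (k, i) else 0)"
    using assms by (intro sum.cong) (auto simp: split_form_index opp_opp)
  also have "\<dots> = X $$ (opp r j, i)"
    using opp_less[OF assms(3)] by simp
  finally show ?thesis .
qed

text \<open>
  Up to the exchange of row halves by the form, the elements of the Lie algebra are the
  antisymmetric matrices.
\<close>

lemma so_even_iff:
  "X \<in> so_even r \<longleftrightarrow> X \<in> carrier_mat (2 * r) (2 * r) \<and>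
     (\<forall>i<2 * r. \<forall>j<2 * r. X $$ (opp r i, j) = - X $$ (opp r j, i))"
proof (cases "X \<in> carrier_mat (2 * r) (2 * r)")
  case True
  let ?Y = "transpose_mat X * split_form r + split_form r * X"
  have entry: "?Y $$ (i, j) = X $$ (opp r j, i) + X $$ (opp r i, j)" if "i < 2 * r" "j < 2 * r" for i j
    using that True split_form_left[OF True that] split_form_right[OF True that] 
    by (simp del: index_mult_mat(1))
  have "?Y = 0\<^sub>m (2 * r) (2 * r) \<longleftrightarrow> (\<forall>i<2 * r. \<forall>j<2 * r. ?Y $$ (i, j) = 0)"
    using True by (auto simp: mat_eq_iff simp del: index_mult_mat(1) index_add_mat(1))
  also have "\<dots> \<longleftrightarrow> (\<forall>i<2 * r. \<forall>j<2 * r. X $$ (opp r i, j) = - X $$ (opp r j, i))"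
    by (auto simp: entry eq_neg_iff_add_eq_0 add.commute simp del: index_add_mat(1))
  finally show ?thesis
    using True by (simp add: so_even_def)
qed (simp add: so_even_def)

lemma so_evenD:
  assumes "X \<in> so_even r"
  shows so_even_carrier: "X \<in> carrier_mat (2 * r) (2 * r)"
    and so_even_opp: "i < 2 * r \<Longrightarrow> j < 2 * r \<Longrightarrow> X $$ (opp r i, j) = - X $$ (opp r j, i)"
  using assms unfolding so_even_iff by blast+

section \<open>The Cartan subalgebra and its weights\<close>

text \<open>
  The diagonal matrix with entries h 0, ..., h (r - 1), - h 0, ..., - h (r - 1).
\<close>

definition cartan_mat :: "nat \<Rightarrow> (nat \<Rightarrow> complex) \<Rightarrow> complex mat" where
  "cartan_mat r h = mat (2 * r) (2 * r)
     (\<lambda>(i, j). if i = j then (if i < r then h i else - h (i - r)) else 0)"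

lemma cartan_mat_in_cartan: "cartan_mat r h \<in> cartan r"
  by (auto simp: cartan_def so_even_iff cartan_mat_def diagonal_mat_def opp_less)
     (auto simp: opp_def split: if_splits)

lemma cartan_opp:
  assumes "H \<in> cartan r" "i < 2 * r"
  shows "H $$ (opp r i, opp r i) = - H $$ (i, i)"
  using so_even_opp[OF _ assms(2) opp_less[OF assms(2)], of H] assms by (simp add: cartan_def opp_opp)

lemma weight_eval_diff: "weight_eval r (a - b) H = weight_eval r a H - weight_eval r b H"
  by (simp add: weight_eval_def sum_subtractf left_diff_distrib)

lemma weight_eval_cartan_mat:
  "weight_eval r a (cartan_mat r h) = (\<Sum>k = 1..r. a k * h (k - 1))"
proof -
  have "cartan_mat r h $$ (k - 1, k - 1) = h (k - 1)" if "k \<in> {1..r}" for k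
  proof -
    have "k - 1 < r"
      using that by auto
    then show ?thesis
      by (simp add: cartan_mat_def)
  qed
  then show ?thesis
    unfolding weight_eval_def by (intro sum.cong) auto
qed

lemma cartan_dual_eqI:
  assumes "a \<in> cartan_dual r" "b \<in> cartan_dual r"
    and "\<And>H. H \<in> cartan r \<Longrightarrow> weight_eval r a H = weight_eval r b H"
  shows "a = b"
proof
  fix k
  show "a k = b k"
  proof (cases "k \<in> {1..r}")
    case True
    have eval: "weight_eval r c (cartan_mat r (eps (k - 1))) = c k" for c
    proof -
      have "weight_eval r c (cartan_mat r (eps (k - 1))) = (\<Sum>l = 1..r. if l = k then c l else 0)"
        unfolding weight_eval_cartan_mat using True by (intro sum.cong) (auto simp: eps_def)
      then show ?thesis
        using True by simp
    qed
    then show ?thesis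
      using assms(3)[OF cartan_mat_in_cartan, of "eps (k - 1)"] by simp
  qed (use assms in \<open>simp add: cartan_dual_def\<close>)
qed

text \<open>
  The weight of the standard basis vector with index i: it is eps 1, ..., eps r on the first half
  of the basis and - eps 1, ..., - eps r on the second.
\<close>

definition vec_weight :: "nat \<Rightarrow> nat \<Rightarrow> weight" where
  "vec_weight r i = (if i < r then eps (i + 1) else - eps (i - r + 1))"

lemma vec_weight_in_dual: "i < 2 * r \<Longrightarrow> vec_weight r i \<in> cartan_dual r"
  by (auto simp: vec_weight_def cartan_dual_def eps_def)

lemma weight_eval_vec_weight:
  assumes "H \<in> cartan r" "i < 2 * r"
  shows "weight_eval r (vec_weight r i) H = H $$ (i, i)"
proof (cases "i < r")
  case True
  have "weight_eval r (vec_weight r i) H = (\<Sum>k = 1..r. if k = i + 1 then H $$ (k - 1, k - 1) else 0)"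
    unfolding weight_eval_def using True by (intro sum.cong) (auto simp: vec_weight_def eps_def)
  then show ?thesis
    using True by simp
next
  case False
  have "weight_eval r (vec_weight r i) H
      = (\<Sum>k = 1..r. if k = i - r + 1 then - H $$ (k - 1, k - 1) else 0)"
    unfolding weight_eval_def using False by (intro sum.cong) (auto simp: vec_weight_def eps_def)
  also have "\<dots> = - H $$ (i - r, i - r)"
    using False assms by (simp add: less_diff_conv2)
  also have "\<dots> = H $$ (i, i)"
    using cartan_opp[OF assms] False by (simp add: opp_def)
  finally show ?thesis .
qed

lemma cartan_commutator:
  assumes H: "H \<in> cartan r" and X: "X \<in> carrier_mat (2 * r) (2 * r)" and ij: "i < 2 * r" "j < 2 * r"
  shows "(H * X - X * H) $$ (i, j) = (H $$ (i, i) - H $$ (j, j)) * X $$ (i, j)"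
proof -
  have Hc: "H \<in> carrier_mat (2 * r) (2 * r)"
    and Hd: "\<And>k l. k < 2 * r \<Longrightarrow> l < 2 * r \<Longrightarrow> k \<noteq> l \<Longrightarrow> H $$ (k, l) = 0"
    using H so_even_carrier[of H r] by (auto simp: cartan_def diagonal_mat_def)
  have "(H * X) $$ (i, j) = (\<Sum>k = 0..<2 * r. H $$ (i, k) * X $$ (k, j))"
    using Hc X ij by (auto simp: scalar_prod_def)
  also have "\<dots> = (\<Sum>k = 0..<2 * r. if k = i then H $$ (i, i) * X $$ (i, j) else 0)"
    using Hd ij by (intro sum.cong) auto
  finally have 1: "(H * X) $$ (i, j) = H $$ (i, i) * X $$ (i, j)"
    using ij by simp
  have "(X * H) $$ (i, j) = (\<Sum>k = 0..<2 * r. X $$ (i, k) * H $$ (k, j))"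
    using Hc X ij by (auto simp: scalar_prod_def)
  also have "\<dots> = (\<Sum>k = 0..<2 * r. if k = j then X $$ (i, j) * H $$ (j, j) else 0)"
    using Hd ij by (intro sum.cong) auto
  finally have 2: "(X * H) $$ (i, j) = X $$ (i, j) * H $$ (j, j)"
    using ij by simp
  show ?thesis
    using Hc X ij 1 2 by (simp add: algebra_simps del: index_mult_mat(1))
qed

section \<open>The roots\<close>

text \<open>
  The Cartan subalgebra acts on the matrix unit in row i and column j with the difference of the
  weights of i and j, so a root is such a difference. The case i = opp r j, which would give 2
  eps k or - 2 eps k, is excluded by antisymmetry.
\<close>

lemma roots_subset:
  assumes "a \<in> roots r"
  shows "\<exists>i<2 * r. \<exists>j<2 * r. i \<noteq> j \<and> i \<noteq> opp r j \<and> a = vec_weight r i - vec_weight r j"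
proof -
  obtain X where a: "a \<in> cartan_dual r" "a \<noteq> 0" and X: "X \<in> so_even r" "X \<noteq> 0\<^sub>m (2 * r) (2 * r)"
    and eig: "\<And>H. H \<in> cartan r \<Longrightarrow> H * X - X * H = weight_eval r a H \<cdot>\<^sub>m X"
    using assms by (auto simp: roots_def)
  have Xc: "X \<in> carrier_mat (2 * r) (2 * r)"
    and Xs: "\<And>i j. i < 2 * r \<Longrightarrow> j < 2 * r \<Longrightarrow> X $$ (opp r i, j) = - X $$ (opp r j, i)"
    using so_evenD[OF X(1)] by blast+
  obtain i j where ij: "i < 2 * r" "j < 2 * r" and nz: "X $$ (i, j) \<noteq> 0"
    using X(2) Xc by (auto simp: mat_eq_iff)
  have "a = vec_weight r i - vec_weight r j"
  proof (rule cartan_dual_eqI)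
    show "vec_weight r i - vec_weight r j \<in> cartan_dual r"
      using vec_weight_in_dual ij by (auto simp: cartan_dual_def)
    fix H assume H: "H \<in> cartan r"
    have "(H $$ (i, i) - H $$ (j, j)) * X $$ (i, j) = weight_eval r a H * X $$ (i, j)"
      using cartan_commutator[OF H Xc ij] Xc ij unfolding eig[OF H] by auto
    then show "weight_eval r a H = weight_eval r (vec_weight r i - vec_weight r j) H"
      using nz H ij by (simp add: weight_eval_diff weight_eval_vec_weight)
  qed (use a in auto)
  moreover have "i \<noteq> j"
    using calculation a(2) by auto
  moreover have "i \<noteq> opp r j"
    using Xs[of j j] ij nz by auto
  ultimately show ?thesis
    using ij by blast
qed

lemma root_vector:
  assumes ij: "i < 2 * r" "j < 2 * r" and ne: "i \<noteq> opp r j"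
    and nz: "vec_weight r i - vec_weight r j \<noteq> 0"
  shows "vec_weight r i - vec_weight r j \<in> roots r"
proof -
  \<comment> \<open>The matrix unit in row i and column j, antisymmetrized with respect to the form.\<close>
  define X :: "complex mat" where "X = mat (2 * r) (2 * r) (\<lambda>(a, b).
    (if a = i \<and> b = j then 1 else 0) - (if a = opp r j \<and> b = opp r i then 1 else 0))"
  have Xc: "X \<in> carrier_mat (2 * r) (2 * r)"
    by (simp add: X_def)
  have opp_eq: "opp r a = b \<longleftrightarrow> a = opp r b" if "a < 2 * r" "b < 2 * r" for a b
    using that by (auto simp: opp_def split: if_splits)
  have X_so: "X \<in> so_even r"
    unfolding so_even_iff
  proof (intro conjI allI impI)
    fix a b assume ab: "a < 2 * r" "b < 2 * r"
    have 1: "X $$ (opp r a, b) = (if opp r a = i \<and> b = j then 1 else 0)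
        - (if opp r a = opp r j \<and> b = opp r i then 1 else 0)"
      using ab opp_less by (simp add: X_def)
    have 2: "X $$ (opp r b, a) = (if opp r b = i \<and> a = j then 1 else 0)
        - (if opp r b = opp r j \<and> a = opp r i then 1 else 0)"
      using ab opp_less by (simp add: X_def)
    have "opp r a = opp r j \<longleftrightarrow> a = j" "opp r b = opp r j \<longleftrightarrow> b = j"
      using ab ij by (auto simp: opp_def split: if_splits)
    then show "X $$ (opp r a, b) = - X $$ (opp r b, a)"
      unfolding 1 2 opp_eq[OF ab(1) ij(1)] opp_eq[OF ab(2) ij(1)] by (simp add: conj_commute)
  qed (rule Xc)
  have "X $$ (i, j) = 1"
    using ij ne by (auto simp: X_def)
  then have X_nz: "X \<noteq> 0\<^sub>m (2 * r) (2 * r)"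
    using ij by auto
  have "H * X - X * H = weight_eval r (vec_weight r i - vec_weight r j) H \<cdot>\<^sub>m X" if H: "H \<in> cartan r" for H
  proof (rule eq_matI)
    fix a b
    assume "a < dim_row (weight_eval r (vec_weight r i - vec_weight r j) H \<cdot>\<^sub>m X)"
      "b < dim_col (weight_eval r (vec_weight r i - vec_weight r j) H \<cdot>\<^sub>m X)"
    then have ab: "a < 2 * r" "b < 2 * r"
      by (auto simp: X_def)
    have "(H $$ (a, a) - H $$ (b, b)) * X $$ (a, b) = (H $$ (i, i) - H $$ (j, j)) * X $$ (a, b)"
    proof (cases "(a = i \<and> b = j) \<or> (a = opp r j \<and> b = opp r i)")
      case True
      then have "H $$ (a, a) - H $$ (b, b) = H $$ (i, i) - H $$ (j, j)"
      proof
        assume "a = opp r j \<and> b = opp r i"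
        then show ?thesis
          by (simp only: cartan_opp[OF H ij(1)] cartan_opp[OF H ij(2)]) simp
      qed simp
      then show ?thesis by simp
    next
      case False
      moreover have "X $$ (a, b) = (if a = i \<and> b = j then 1 else 0)
          - (if a = opp r j \<and> b = opp r i then 1 else 0)"
        using ab by (simp add: X_def)
      ultimately have "X $$ (a, b) = 0"
        by (simp only: de_Morgan_disj if_False) simp
      then show ?thesis by (simp only: mult_zero_right)
    qed
    then show "(H * X - X * H) $$ (a, b)
        = (weight_eval r (vec_weight r i - vec_weight r j) H \<cdot>\<^sub>m X) $$ (a, b)"
      unfolding cartan_commutator[OF H Xc ab]
      using ab Xc by (simp add: weight_eval_diff weight_eval_vec_weight[OF H] ij)
  qed (use H so_even_carrier[of H r] in \<open>auto simp: X_def cartan_def\<close>)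
  moreover have "vec_weight r i - vec_weight r j \<in> cartan_dual r"
    using vec_weight_in_dual ij by (auto simp: cartan_dual_def)
  ultimately show ?thesis
    using X_so X_nz nz unfolding roots_def by blast
qed

section \<open>Nonnegative integral combinations\<close>

text \<open>
  The sums of finitely many elements of S, repetitions allowed.
\<close>

definition nonneg_span :: "weight set \<Rightarrow> weight set" where
  "nonneg_span S = {\<Sum>\<^sub># M | M. set_mset M \<subseteq> S}"

lemma nonneg_span_zero: "0 \<in> nonneg_span S"
  unfolding nonneg_span_def by (force intro: exI[of _ "{#}"])

lemma nonneg_span_base: "a \<in> S \<Longrightarrow> a \<in> nonneg_span S"
  unfolding nonneg_span_def by (force intro: exI[of _ "{#a#}"])

lemma nonneg_span_add: 
  assumes "a \<in> nonneg_span S" "b \<in> nonneg_span S"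
  shows "a + b \<in> nonneg_span S"
proof -
  obtain M N where "a = \<Sum>\<^sub># M" "set_mset M \<subseteq> S" "b = \<Sum>\<^sub># N" "set_mset N \<subseteq> S"
    using assms unfolding nonneg_span_def by blast
  then have "a + b = \<Sum>\<^sub># (M + N)" "set_mset (M + N) \<subseteq> S"
    by auto
  then show ?thesis
    unfolding nonneg_span_def by blast
qed

lemma nonneg_span_sum:
  "(\<And>i. i \<in> I \<Longrightarrow> f i \<in> nonneg_span S) \<Longrightarrow> (\<Sum>i\<in>I. f i) \<in> nonneg_span S"
  by (induction I rule: infinite_finite_induct) (auto intro: nonneg_span_zero nonneg_span_add)

lemma nonneg_span_scale:
  assumes "a \<in> nonneg_span S"
  shows "(\<lambda>k. of_nat n * a k) \<in> nonneg_span S"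
proof (induction n)
  case 0
  have "(\<lambda>k. of_nat 0 * a k) = 0"
    by (simp add: fun_eq_iff)
  then show ?case
    using nonneg_span_zero[of S] by simp
next
  case (Suc n)
  have "(\<lambda>k. of_nat (Suc n) * a k) = a + (\<lambda>k. of_nat n * a k)"
    by (simp add: fun_eq_iff algebra_simps)
  then show ?case
    using nonneg_span_add[OF assms Suc] by simp
qed

lemma sum_apply: "(\<Sum>i\<in>I. f i) k = (\<Sum>i\<in>I. (f i k :: complex))"
  by (induction I rule: infinite_finite_induct) auto

section \<open>The positive roots\<close>

text \<open>
  The linear functional that takes the value 1 on each simple root. Its coefficients r - k are the
  coordinates of rho.
\<close>

definition height :: "nat \<Rightarrow> weight \<Rightarrow> complex" where
  "height r a = (\<Sum>k = 1..r. of_nat (r - k) * a k)"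

lemma height_zero [simp]: "height r 0 = 0"
  by (simp add: height_def)

lemma height_add [simp]: "height r (a + b) = height r a + height r b"
  by (simp add: height_def sum.distrib distrib_left)

lemma height_uminus [simp]: "height r (- a) = - height r a"
  by (simp add: height_def sum_negf)

lemma height_diff [simp]: "height r (a - b) = height r a - height r b"
  by (simp add: height_def sum_subtractf right_diff_distrib)

lemma height_eps:
  assumes "i \<in> {1..r}"
  shows "height r (eps i) = of_nat (r - i)"
proof -
  have "height r (eps i) = (\<Sum>k = 1..r. if k = i then of_nat (r - k) else 0)"
    unfolding height_def by (intro sum.cong) (auto simp: eps_def)
  then show ?thesis
    using assms by simp
qed

lemma height_simple_root:
  assumes "r \<ge> 2" "i \<in> {1..r}"
  shows "height r (simple_root r i) = 1"
  using assms by (auto simp: simple_root_def height_eps)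

lemma height_sum_simple_roots:
  assumes "r \<ge> 2"
  shows "set_mset M \<subseteq> simple_root r ` {1..r} \<Longrightarrow> height r (\<Sum>\<^sub># M) = of_nat (size M)"
  by (induction M) (use assms in \<open>auto simp: height_simple_root\<close>)

text \<open>
  The pairs of indices i < j between 1 and r.
\<close>

definition index_pairs :: "nat \<Rightarrow> (nat \<times> nat) set" where
  "index_pairs r = (SIGMA i:{1..r}. {i<..r})"

lemma finite_index_pairs [simp]: "finite (index_pairs r)"
  by (simp add: index_pairs_def)

lemma simple_root_span_diff:
  assumes "1 \<le> i" "i \<le> j" "j \<le> r"
  shows "eps i - eps j \<in> nonneg_span (simple_root r ` {1..r})"
  using assms(2,3)
proof (induction rule: dec_induct)
  case base
  then show ?case
    using nonneg_span_zero by (simp add: zero_fun_def)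
next
  case (step l)
  have "eps l - eps (Suc l) = simple_root r l"
    using step by (simp add: simple_root_def)
  then have "eps l - eps (Suc l) \<in> nonneg_span (simple_root r ` {1..r})"
    using step assms(1) by (auto intro!: nonneg_span_base)
  moreover have "eps i - eps l \<in> nonneg_span (simple_root r ` {1..r})"
    by (rule step.IH) (use step in simp)
  moreover have "eps i - eps (Suc l) = (eps i - eps l) + (eps l - eps (Suc l))"
    by (rule ext) simp
  ultimately show ?case
    by (simp only: nonneg_span_add)
qed

lemma simple_root_span_add:
  assumes "1 \<le> i" "i < j" "j \<le> r"
  shows "eps i + eps j \<in> nonneg_span (simple_root r ` {1..r})"
proof -
  have "simple_root r r \<in> nonneg_span (simple_root r ` {1..r})"
    using assms by (auto intro!: nonneg_span_base)
  then have "(eps i - eps (r - 1)) + (eps j - eps r) + simple_root r r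
      \<in> nonneg_span (simple_root r ` {1..r})"
    using assms by (intro nonneg_span_add simple_root_span_diff) auto
  also have "(eps i - eps (r - 1)) + (eps j - eps r) + simple_root r r = eps i + eps j"
    by (simp add: simple_root_def)
  finally show ?thesis .
qed

text \<open>
  The positive roots are eps i + eps j and eps i - eps j for i < j. The other roots are excluded
  by their height, which would have to be the size of a multiset of simple roots.
\<close>

lemma positive_roots_eq:
  assumes "r \<ge> 2"
  shows "positive_roots r = (\<lambda>(i, j). eps i + eps j) ` index_pairs r
    \<union> (\<lambda>(i, j). eps i - eps j) ` index_pairs r"
proof (intro equalityI subsetI)
  fix a assume "a \<in> positive_roots r"
  then obtain M where a: "a \<in> roots r" and M: "set_mset M \<subseteq> simple_root r ` {1..r}" "a = \<Sum>\<^sub># M"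
    unfolding positive_roots_def by blast
  obtain i j where ij: "i < 2 * r" "j < 2 * r" "i \<noteq> j" "i \<noteq> opp r j"
    and a_eq: "a = vec_weight r i - vec_weight r j"
    using roots_subset[OF a] by blast
  have ht: "height r a = of_nat (size M)"
    unfolding M(2) by (rule height_sum_simple_roots[OF assms M(1)])
  \<comment> \<open>A difference eps p - eps q in the positive cone has nonnegative height, hence p < q.\<close>
  have pos: "(\<lambda>(i, j). eps i - eps j) (p, q) \<in> (\<lambda>(i, j). eps i - eps j) ` index_pairs r"
    if "p \<in> {1..r}" "q \<in> {1..r}" "p \<noteq> q" "a = eps p - eps q" for p q
  proof -
    have "(of_nat (r - p) :: complex) = of_nat (size M + (r - q))"
      using ht that by (simp add: height_eps algebra_simps)
    then have "r - p = size M + (r - q)"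
      by (simp only: of_nat_eq_iff)
    then have "(p, q) \<in> index_pairs r"
      using that by (auto simp: index_pairs_def)
    then show ?thesis
      by (rule imageI)
  qed
  have sym: "eps p + eps q \<in> (\<lambda>(i, j). eps i + eps j) ` index_pairs r"
    if "p \<in> {1..r}" "q \<in> {1..r}" "p \<noteq> q" for p q
  proof (cases "p < q")
    case True
    then have "(p, q) \<in> index_pairs r"
      using that by (auto simp: index_pairs_def)
    then show ?thesis by force
  next
    case False
    then have "(q, p) \<in> index_pairs r"
      using that by (auto simp: index_pairs_def)
    then show ?thesis by (force simp: add.commute)
  qed
  consider "i < r" "j < r" | "i < r" "j \<ge> r" | "i \<ge> r" "j < r" | "i \<ge> r" "j \<ge> r"
    by linarith
  then show "a \<in> (\<lambda>(i, j). eps i + eps j) ` index_pairs r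
    \<union> (\<lambda>(i, j). eps i - eps j) ` index_pairs r"
  proof cases
    case 1
    then have "a = eps (i + 1) - eps (j + 1)"
      by (simp add: a_eq vec_weight_def)
    then show ?thesis
      using pos[of "i + 1" "j + 1"] 1 ij by simp
  next
    case 2
    then have "a = eps (i + 1) + eps (j - r + 1)"
      by (simp add: a_eq vec_weight_def)
    moreover have "i + 1 \<noteq> j - r + 1"
      using 2 ij by (simp add: opp_def)
    ultimately show ?thesis
      using sym[of "i + 1" "j - r + 1"] 2 ij by simp
  next
    case 3
    then have a': "a = - eps (i - r + 1) - eps (j + 1)"
      by (simp add: a_eq vec_weight_def)
    \<comment> \<open>The height is at most 0, and it is 0 only if both indices are equal to r, which i \<noteq> opp r j excludes.\<close>
    have "i - r + 1 \<in> {1..r}" "j + 1 \<in> {1..r}"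
      using 3 ij by auto
    then have "height r a = - of_nat (r - (i - r + 1)) - of_nat (r - (j + 1))"
      unfolding a' height_diff height_uminus by (simp only: height_eps)
    then have "(of_nat (size M + (r - (i - r + 1)) + (r - (j + 1))) :: complex) = of_nat 0"
      unfolding ht by (simp add: algebra_simps eq_neg_iff_add_eq_0)
    then have "size M + (r - (i - r + 1)) + (r - (j + 1)) = 0"
      by (simp only: of_nat_eq_iff)
    then show ?thesis
      using 3 ij by (simp add: opp_def)
  next
    case 4
    then have "a = eps (j - r + 1) - eps (i - r + 1)"
      by (simp add: a_eq vec_weight_def)
    then show ?thesis
      using pos[of "j - r + 1" "i - r + 1"] 4 ij by simp
  qed
next
  fix a assume "a \<in> (\<lambda>(i, j). eps i + eps j) ` index_pairs r
    \<union> (\<lambda>(i, j). eps i - eps j) ` index_pairs r"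
  then obtain i j where ij: "1 \<le> i" "i < j" "j \<le> r" and a: "a = eps i + eps j \<or> a = eps i - eps j"
    by (auto simp: index_pairs_def)
  have lt: "i - 1 < r" "j - 1 < r" "\<not> j - 1 + r < r" "j - 1 + r - r + 1 = j"
    using ij by auto
  have "a i = 1"
    using a ij by (auto simp: eps_def)
  then have nz: "a \<noteq> 0"
    by auto
  have "a \<in> nonneg_span (simple_root r ` {1..r})"
    using a ij simple_root_span_diff[of i j r] simple_root_span_add[of i j r] by auto
  moreover have "a \<in> roots r"
  proof (cases "a = eps i - eps j")
    case True
    then have "a = vec_weight r (i - 1) - vec_weight r (j - 1)"
      using ij lt by (simp add: vec_weight_def)
    then show ?thesis
      using root_vector[of "i - 1" r "j - 1"] nz ij lt by (simp add: opp_def)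
  next
    case False
    then have "a = vec_weight r (i - 1) - vec_weight r (j - 1 + r)"
      using a ij lt by (simp add: vec_weight_def)
    then show ?thesis
      using root_vector[of "i - 1" r "j - 1 + r"] nz ij lt by (simp add: opp_def)
  qed
  ultimately show "a \<in> positive_roots r"
    unfolding positive_roots_def nonneg_span_def by blast
qed

lemma finite_positive_roots: "r \<ge> 2 \<Longrightarrow> finite (positive_roots r)"
  by (simp add: positive_roots_eq)

text \<open>
  A positive root determines its pair of indices.
\<close>

lemma eps_pair_support:
  assumes "(i, j) \<in> index_pairs r" "a = eps i + eps j \<or> a = eps i - eps j"
  shows "i = (LEAST k. a k \<noteq> 0)" "j = (GREATEST k. a k \<noteq> 0)"
proof -
  have ij: "i < j"
    using assms(1) by (simp add: index_pairs_def)
  have supp: "a i \<noteq> 0" "a j \<noteq> 0"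
    using assms(2) ij by (auto simp: eps_def)
  have range: "i \<le> k \<and> k \<le> j" if "a k \<noteq> 0" for k
    using that assms(2) ij by (auto simp: eps_def split: if_splits)
  show "i = (LEAST k. a k \<noteq> 0)"
    using supp range by (intro Least_equality[symmetric]) auto
  show "j = (GREATEST k. a k \<noteq> 0)"
    using supp range by (intro Greatest_equality[symmetric]) auto
qed

text \<open>
  rho = (r - 1, ..., 1, 0): for each pair i < j the roots eps i + eps j and eps i - eps j add up
  to 2 eps i.
\<close>

lemma rho_eq:
  assumes "r \<ge> 2"
  shows "rho r k = of_nat (if k = 0 then 0 else r - k)"
proof -
  have inj1: "inj_on (\<lambda>(i, j). eps i + eps j) (index_pairs r)"
  proof (rule inj_onI, clarify)
    fix i j i' j' assume *: "(i, j) \<in> index_pairs r" "(i', j') \<in> index_pairs r" "eps i + eps j = eps i' + eps j'"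
    show "i = i' \<and> j = j'"
      using eps_pair_support[OF *(1), of "eps i + eps j"] eps_pair_support[OF *(2), of "eps i' + eps j'"] *(3)
      by simp
  qed
  have inj2: "inj_on (\<lambda>(i, j). eps i - eps j) (index_pairs r)"
  proof (rule inj_onI, clarify)
    fix i j i' j' assume *: "(i, j) \<in> index_pairs r" "(i', j') \<in> index_pairs r" "eps i - eps j = eps i' - eps j'"
    show "i = i' \<and> j = j'"
      using eps_pair_support[OF *(1), of "eps i - eps j"] eps_pair_support[OF *(2), of "eps i' - eps j'"] *(3)
      by simp
  qed
  have disj: "(\<lambda>(i, j). eps i + eps j) ` index_pairs r \<inter> (\<lambda>(i, j). eps i - eps j) ` index_pairs r = {}"
  proof -
    have False if "(i, j) \<in> index_pairs r" "(i', j') \<in> index_pairs r" "eps i + eps j = eps i' - eps j'" for i j i' j'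
    proof -
      have "j = j'"
        using eps_pair_support[OF that(1), of "eps i + eps j"] eps_pair_support[OF that(2), of "eps i' - eps j'"] that(3)
        by simp
      then have "(eps i + eps j) j = 1" "(eps i' - eps j') j = -1"
        using that(1,2) by (auto simp: eps_def index_pairs_def)
      then have "(1 :: complex) = -1"
        using that(3) by metis
      then show False
        by simp
    qed
    then show ?thesis by fast
  qed
  let ?P = "\<lambda>(i, j). eps i + eps j" and ?Q = "\<lambda>(i, j). eps i - eps j"
  have "(\<Sum>\<beta> \<in> positive_roots r. \<beta> k)
      = (\<Sum>\<beta> \<in> ?P ` index_pairs r. \<beta> k) + (\<Sum>\<beta> \<in> ?Q ` index_pairs r. \<beta> k)"
    unfolding positive_roots_eq[OF assms] by (rule sum.union_disjoint) (simp_all add: disj)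
  also have "\<dots> = (\<Sum>p\<in>index_pairs r. ?P p k) + (\<Sum>p\<in>index_pairs r. ?Q p k)"
    by (simp only: sum.reindex[OF inj1] sum.reindex[OF inj2] o_def)
  also have "\<dots> = (\<Sum>(i, j)\<in>index_pairs r. 2 * eps i k)"
    by (simp flip: sum.distrib add: case_prod_unfold)
  also have "\<dots> = (\<Sum>i = 1..r. \<Sum>j\<in>{i<..r}. 2 * eps i k)"
    unfolding index_pairs_def by (subst sum.Sigma) auto
  also have "\<dots> = (\<Sum>i = 1..r. if i = k then of_nat (2 * (r - i)) else 0)"
    by (intro sum.cong) (auto simp: eps_def)
  also have "\<dots> = of_nat (2 * (if k = 0 then 0 else r - k))"
    by auto
  finally show ?thesis
    by (simp add: rho_def)
qed

section \<open>The Weyl group as a group of signed permutations\<close>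

lemma weight_form_eps: "i \<in> {1..r} \<Longrightarrow> weight_form r v (eps i) = v i"
proof -
  assume "i \<in> {1..r}"
  moreover have "weight_form r v (eps i) = (\<Sum>k = 1..r. if k = i then v k else 0)"
    unfolding weight_form_def by (intro sum.cong) (auto simp: eps_def)
  ultimately show ?thesis by simp
qed

lemma weight_form_add: "weight_form r v (a + b) = weight_form r v a + weight_form r v b"
  by (simp add: weight_form_def sum.distrib distrib_left)

lemma weight_form_diff: "weight_form r v (a - b) = weight_form r v a - weight_form r v b"
  by (simp add: weight_form_def sum_subtractf right_diff_distrib)

lemma simple_reflection_swap:
  assumes "1 \<le> i" "i < r"
  shows "simple_reflection r i v = v \<circ> transpose i (i + 1)"
proof -
  have "weight_form r a (simple_root r i) = a i - a (i + 1)" for a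
    using assms by (simp add: simple_root_def weight_form_diff weight_form_eps)
  then show ?thesis
    using assms by (auto simp: simple_reflection_def simple_root_def eps_def fun_eq_iff transpose_def
        diff_divide_distrib)
qed

lemma simple_reflection_last:
  assumes "r \<ge> 2"
  shows "simple_reflection r r v k
    = (if k \<in> {r - 1, r} then - 1 else 1) * v (transpose (r - 1) r k)"
proof -
  have "weight_form r a (simple_root r r) = a (r - 1) + a r" for a
    using assms by (simp add: simple_root_def weight_form_add weight_form_eps)
  then show ?thesis
    using assms by (auto simp: simple_reflection_def simple_root_def eps_def transpose_def add_divide_distrib)
qed

text \<open>
  An element of the Weyl group permutes the coordinates and changes an even number of signs.
\<close>

lemma weyl_group_signed_permutation:
  assumes r: "r \<ge> 2" and "w \<in> weyl_group r"
  shows "\<exists>s p. p permutes {1..r} \<and> (\<forall>k. s k = 1 \<or> s k = -1) \<and> (\<forall>k. k \<notin> {1..r} \<longrightarrow> s k = 1)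
    \<and> (\<Prod>k = 1..r. s k) = 1 \<and> w = (\<lambda>v k. s k * v (p k))"
  using assms(2)
proof induction
  case id
  show ?case
    using permutes_id[of "{1..r}"]
    by (intro exI[of _ "\<lambda>_. 1 :: complex"] exI[of _ id]) (auto simp: fun_eq_iff id_def)
next
  case (refl i w)
  obtain s p where p: "p permutes {1..r}" and s: "\<And>k. s k = 1 \<or> s k = -1" "\<And>k. k \<notin> {1..r} \<Longrightarrow> s k = 1"
    and ps: "(\<Prod>k = 1..r. s k) = 1" and w: "w = (\<lambda>v k. s k * v (p k))"
    using refl.IH by blast
  show ?case
  proof (cases "i < r")
    case True
    let ?t = "transpose i (i + 1)"
    have t: "?t permutes {1..r}"
      using refl.hyps True by (intro permutes_swap_id) auto
    have "p \<circ> ?t permutes {1..r}"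
      using permutes_compose[OF t p] .
    moreover have "(s \<circ> ?t) k = 1" if "k \<notin> {1..r}" for k
      using s(2)[OF that] permutes_not_in[OF t that] by simp
    moreover have "(\<Prod>k = 1..r. (s \<circ> ?t) k) = 1"
      using prod.permute[OF t, of s] ps by simp
    moreover have "simple_reflection r i \<circ> w = (\<lambda>v k. (s \<circ> ?t) k * v ((p \<circ> ?t) k))"
      using True refl.hyps simple_reflection_swap[of i r] by (simp add: w fun_eq_iff)
    moreover have "(s \<circ> ?t) k = 1 \<or> (s \<circ> ?t) k = -1" for k
      using s(1)[of "?t k"] by simp
    ultimately show ?thesis
      by (intro exI[of _ "s \<circ> ?t"] exI[of _ "p \<circ> ?t"]) blast
  next
    case False
    then have i: "i = r"
      using refl.hyps by simp
    let ?t = "transpose (r - 1) r"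
    let ?c = "\<lambda>k. (if k \<in> {r - 1, r} then - 1 else 1) :: complex"
    have t: "?t permutes {1..r}"
      using r by (intro permutes_swap_id) auto
    have "p \<circ> ?t permutes {1..r}"
      using permutes_compose[OF t p] .
    moreover have "?c k * s (?t k) = 1" if "k \<notin> {1..r}" for k
      using s(2)[OF that] permutes_not_in[OF t that] that r by auto
    moreover have "(\<Prod>k = 1..r. ?c k * s (?t k)) = 1"
    proof -
      have "(\<Prod>k = 1..r. ?c k) = (\<Prod>k \<in> {r - 1, r}. ?c k)"
        using r by (intro prod.mono_neutral_right) auto
      also have "\<dots> = 1"
        using r by simp
      finally show ?thesis
        using prod.permute[OF t, of s] ps by (simp add: prod.distrib o_def)
    qed
    moreover have "simple_reflection r i \<circ> w = (\<lambda>v k. (?c k * s (?t k)) * v ((p \<circ> ?t) k))"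
      by (simp add: w fun_eq_iff i simple_reflection_last[OF r])
    moreover have "?c k * s (?t k) = 1 \<or> ?c k * s (?t k) = -1" for k
      using s(1)[of "?t k"] by auto
    ultimately show ?thesis
      by (intro exI[of _ "\<lambda>k. ?c k * s (?t k)"] exI[of _ "p \<circ> ?t"]) blast
  qed
qed

lemma weyl_group_comp:
  assumes "v \<in> weyl_group r" "w \<in> weyl_group r"
  shows "v \<circ> w \<in> weyl_group r"
  using assms by induction (auto simp: comp_assoc intro: weyl_group.intros)

lemma weyl_group_transposition:
  assumes "1 \<le> a" "a < b" "b \<le> r"
  shows "(\<lambda>v. v \<circ> transpose a b) \<in> weyl_group r"
proof -
  have adj: "(\<lambda>v. v \<circ> transpose i (Suc i)) \<in> weyl_group r" if "1 \<le> i" "i < r" for i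
  proof -
    have "(\<lambda>v. v \<circ> transpose i (Suc i)) = simple_reflection r i \<circ> id"
      using simple_reflection_swap[OF that] by auto
    then show ?thesis
      using weyl_group.refl[OF _ weyl_group.id, of i r] that by simp
  qed
  from assms(2) have "Suc a \<le> b" by simp
  then show ?thesis
    using assms(3)
  proof (induction rule: dec_induct)
    case base
    then show ?case
      by (intro adj) (use assms(1) in auto)
  next
    case (step l)
    have "transpose l (Suc l) \<circ> transpose a l \<circ> transpose l (Suc l) = transpose a (Suc l)"
      using step.hyps by (auto simp: fun_eq_iff transpose_def)
    then have "(\<lambda>v. v \<circ> transpose a (Suc l)) = (\<lambda>v. v \<circ> transpose l (Suc l)) \<circ>
        ((\<lambda>v. v \<circ> transpose a l) \<circ> (\<lambda>v :: weight. v \<circ> transpose l (Suc l)))"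
      by (auto simp: fun_eq_iff)
    moreover have "\<dots> \<in> weyl_group r"
      by (intro weyl_group_comp adj step.IH) (use step.prems step.hyps assms(1) in auto)
    ultimately show ?case
      by (simp only:)
  qed
qed

lemma weyl_group_permutation:
  assumes "p permutes {1..r}"
  shows "(\<lambda>v. v \<circ> p) \<in> weyl_group r"
proof -
  have "finite {1..r}" by simp
  then show ?thesis
    using assms
  proof (induction p rule: permutes_rev_induct)
    case id
    show ?case
      using weyl_group.id by (simp add: id_def)
  next
    case (swap a b p)
    have "(\<lambda>v. v \<circ> transpose a b) \<in> weyl_group r"
      using swap.hyps weyl_group_transposition[of a b r] weyl_group_transposition[of b a r]
      by (cases "a < b") (auto simp: transpose_commute)
    from weyl_group_comp[OF this swap.IH] show ?case
      by (simp add: o_def)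
  qed
qed

section \<open>Counting orderings with dominating partial sums\<close>

text \<open>
  The partial sum condition for the positions 2, ..., r - 1, in which the coordinates 2, 2, 3,
  ..., r - 2 have to be placed. A coordinate is represented by its label x in {1..r - 2}, and its
  value is max 2 x, so that the labels 1 and 2 both stand for the value 2. At each position the
  value of rho is the number of labels not yet placed, the present one included. The number e is
  the excess that the earlier partial sum has over that of rho, and it has to stay nonnegative.
\<close>

fun dominating :: "nat \<Rightarrow> nat list \<Rightarrow> bool" where
  "dominating e [] = True"
| "dominating e (x # xs) = (Suc (length xs) \<le> e + max 2 x
     \<and> dominating (e + max 2 x - Suc (length xs)) xs)"

lemma dominating_iff:
  "dominating e xs \<longleftrightarrow>
     (\<forall>k\<le>length xs. (\<Sum>i<k. length xs - i) \<le> e + (\<Sum>i<k. max 2 (xs ! i)))"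
proof (induction xs arbitrary: e)
  case (Cons x xs)
  let ?n = "length xs"
  let ?P = "\<lambda>k. (\<Sum>i<k. Suc ?n - i) \<le> e + (\<Sum>i<k. max 2 ((x # xs) ! i))"
  \<comment> \<open>Splitting off the first summand on both sides leaves the condition for the tail.\<close>
  have shift: "?P (Suc k) \<longleftrightarrow> Suc ?n + (\<Sum>i<k. ?n - i) \<le> e + max 2 x + (\<Sum>i<k. max 2 (xs ! i))" for k
    by (simp add: sum.lessThan_Suc_shift add.assoc del: sum.lessThan_Suc)
  have "(\<forall>k\<le>Suc ?n. ?P k) \<longleftrightarrow> (\<forall>k\<le>?n. ?P (Suc k))"
  proof safe
    fix k assume *: "\<forall>k\<le>?n. ?P (Suc k)" "k \<le> Suc ?n"
    then show "?P k"
      by (cases k) auto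
  qed auto
  also have "\<dots> \<longleftrightarrow> dominating e (x # xs)"
  proof
    assume *: "\<forall>k\<le>?n. ?P (Suc k)"
    have le: "Suc ?n \<le> e + max 2 x"
      using *[unfolded shift, rule_format, of 0] by simp
    moreover have "dominating (e + max 2 x - Suc ?n) xs"
      unfolding Cons.IH
    proof (intro allI impI)
      fix k assume "k \<le> ?n"
      then show "(\<Sum>i<k. ?n - i) \<le> e + max 2 x - Suc ?n + (\<Sum>i<k. max 2 (xs ! i))"
        using *[unfolded shift, rule_format, of k] le by linarith
    qed
    ultimately show "dominating e (x # xs)"
      by simp
  next
    assume "dominating e (x # xs)"
    then have le: "Suc ?n \<le> e + max 2 x"
      and *: "\<And>k. k \<le> ?n \<Longrightarrow> (\<Sum>i<k. ?n - i) \<le> e + max 2 x - Suc ?n + (\<Sum>i<k. max 2 (xs ! i))"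
      by (auto simp: Cons.IH)
    show "\<forall>k\<le>?n. ?P (Suc k)"
      unfolding shift
    proof (intro allI impI)
      fix k assume "k \<le> ?n"
      then show "Suc ?n + (\<Sum>i<k. ?n - i) \<le> e + max 2 x + (\<Sum>i<k. max 2 (xs ! i))"
        using *[of k] le by linarith
    qed
  qed
  finally show ?case by simp
qed simp

text \<open>
  The orderings of the labels 1, ..., n for which the condition holds with initial excess 1. The
  excess 1 comes from the first position, where the coordinate r faces the value r - 1 of rho.
\<close>

definition dominating_orderings :: "nat \<Rightarrow> nat list set" where
  "dominating_orderings n = {xs. distinct xs \<and> set xs = {1..n} \<and> dominating 1 xs}"

lemma length_ordering: "distinct xs \<Longrightarrow> set xs = {1..n} \<Longrightarrow> length xs = (n :: nat)"
  using distinct_card[of xs] by simp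

text \<open>
  For n at most 3 every ordering qualifies, because the initial excess is 1 and each value is at
  least 2.
\<close>

lemma card_dominating_orderings_small:
  assumes "n \<le> 3"
  shows "card (dominating_orderings n) = fact n"
proof -
  have "dominating 1 xs" if "length xs \<le> 3" for xs
  proof -
    have "length xs = 0 \<or> length xs = Suc 0 \<or> length xs = Suc (Suc 0)
      \<or> length xs = Suc (Suc (Suc 0))"
      using that by linarith
    then show ?thesis
      by (elim disjE) (auto simp: length_Suc_conv)
  qed
  then have "dominating_orderings n = permutations_of_set {1..n}"
    using assms length_ordering[of _ n] by (auto simp: dominating_orderings_def permutations_of_set_def)
  then show ?thesis
    by simp
qed

lemma finite_dominating_orderings: "finite (dominating_orderings n)"
proof (rule finite_subset)
  show "dominating_orderings n \<subseteq> permutations_of_set {1..n}"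
    by (auto simp: dominating_orderings_def permutations_of_set_def)
qed simp

text \<open>
  With excess 1 the first label is n or n - 1. After n the excess is 1 again; after n - 1 it is 0,
  and then n has to follow and brings it back to 1. For n = 3 the label 1 could come first as
  well, since its value is also n - 1 = 2.
\<close>

lemma dominating_orderings_rec:
  assumes "n \<ge> 4"
  shows "dominating_orderings n = (#) n ` dominating_orderings (n - 1)
    \<union> (\<lambda>xs. (n - 1) # n # xs) ` dominating_orderings (n - 2)"
proof (intro equalityI subsetI)
  fix xs assume "xs \<in> dominating_orderings n"
  then have xs: "distinct xs" "set xs = {1..n}" "dominating 1 xs"
    by (auto simp: dominating_orderings_def)
  have len: "length xs = n"
    using length_ordering xs by blast
  then obtain x ys where Cons: "xs = x # ys" and ly: "Suc (length ys) = n"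
    using assms by (cases xs) auto
  have x: "x \<in> {1..n}" "n \<le> 1 + max 2 x" and dom: "dominating (1 + max 2 x - n) ys"
    using xs unfolding Cons by (auto simp: ly)
  consider "x = n" | "x = n - 1"
    using x assms by fastforce
  then show "xs \<in> (#) n ` dominating_orderings (n - 1)
    \<union> (\<lambda>xs. (n - 1) # n # xs) ` dominating_orderings (n - 2)"
  proof cases
    case 1
    have "set ys = {1..n} - {n}"
      using xs 1 unfolding Cons by auto
    also have "\<dots> = {1..n - 1}"
      by auto
    finally have "ys \<in> dominating_orderings (n - 1)"
      using xs dom 1 assms by (auto simp: dominating_orderings_def Cons)
    then show ?thesis
      using Cons 1 by blast
  next
    case 2
    obtain z zs where Cons2: "ys = z # zs" and lz: "Suc (Suc (length zs)) = n"
      using ly assms by (cases ys) auto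
    have z: "z \<in> {1..n}" "z \<noteq> n - 1" "n - 1 \<le> max 2 z"
      using xs dom 2 assms lz unfolding Cons Cons2 by auto
    then have zn: "z = n"
      using assms by (auto simp: max_def split: if_splits)
    have "set zs = {1..n} - {n, n - 1}"
      using xs 2 zn unfolding Cons Cons2 by auto
    also have "\<dots> = {1..n - 2}"
      by auto
    finally have "zs \<in> dominating_orderings (n - 2)"
      using xs dom 2 zn assms lz by (auto simp: dominating_orderings_def Cons Cons2)
    then show ?thesis
      using Cons Cons2 2 zn by blast
  qed
next
  fix xs assume "xs \<in> (#) n ` dominating_orderings (n - 1)
    \<union> (\<lambda>xs. (n - 1) # n # xs) ` dominating_orderings (n - 2)"
  then show "xs \<in> dominating_orderings n"
  proof
    assume "xs \<in> (#) n ` dominating_orderings (n - 1)"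
    then obtain ys where ys: "xs = n # ys" "distinct ys" "set ys = {1..n - 1}" "dominating 1 ys"
      by (auto simp: dominating_orderings_def)
    have "Suc (length ys) = n"
      using length_ordering[OF ys(2,3)] assms by simp
    moreover have "insert n {1..n - 1} = {1..n}"
      using assms by auto
    ultimately show ?thesis
      using ys assms by (auto simp: dominating_orderings_def)
  next
    assume "xs \<in> (\<lambda>xs. (n - 1) # n # xs) ` dominating_orderings (n - 2)"
    then obtain ys where ys: "xs = (n - 1) # n # ys" "distinct ys" "set ys = {1..n - 2}" "dominating 1 ys"
      by (auto simp: dominating_orderings_def)
    have len: "Suc (Suc (length ys)) = n"
      using length_ordering[OF ys(2,3)] assms by simp
    have ins: "insert (n - 1) (insert n {1..n - 2}) = {1..n}"
      using assms by auto
    have "n - Suc (length ys) = 1"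
      using len by simp
    then have "dominating 1 xs"
      using ys(4) assms len by (simp add: ys(1))
    moreover have "distinct xs"
      using ys assms by auto
    ultimately show ?thesis
      using ys ins by (simp add: dominating_orderings_def del: dominating.simps)
  qed
qed

lemma card_dominating_orderings_rec:
  assumes "n \<ge> 4"
  shows "card (dominating_orderings n) = card (dominating_orderings (n - 1)) + card (dominating_orderings (n - 2))"
proof -
  have "(#) n ` dominating_orderings (n - 1) \<inter> (\<lambda>xs. (n - 1) # n # xs) ` dominating_orderings (n - 2) = {}"
    using assms by auto
  then show ?thesis
    unfolding dominating_orderings_rec[OF assms]
    by (subst card_Un_disjoint) (simp_all add: finite_dominating_orderings card_image inj_on_def)
qed

lemma card_dominating_orderings:
  "m \<ge> 1 \<Longrightarrow> card (dominating_orderings (m + 1)) = fib_tilde m"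
proof (induction m rule: fib_tilde.induct)
  case 2
  then show ?case
    using card_dominating_orderings_small[of 2] by (simp add: numeral_2_eq_2)
next
  case 3
  then show ?case
    using card_dominating_orderings_small[of 3] by (simp add: eval_nat_numeral)
next
  case (4 n)
  then show ?case
    using card_dominating_orderings_rec[of "n + 4"] by (simp add: eval_nat_numeral)
qed simp

text \<open>
  The coordinates (r, r - 2, r - 3, ..., 3, 2, 2, 0) of the sum of rho and the simple roots, for r
  at least 4. Outside 1, ..., r the value is 0, where for k > r the truncated subtraction is used.
\<close>

definition shifted_coord :: "nat \<Rightarrow> nat \<Rightarrow> nat" where
  "shifted_coord r k = (if k = 0 then 0 else r - k) + (if k = 1 then 1 else 0)
     + (if k = r - 1 then 1 else 0)"

text \<open>
  The permutations p for which the vector with coordinates shifted_coord r (p 1), ...,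
  shifted_coord r (p r) ends in the coordinate 0 and has partial sums at least those of rho.
\<close>

definition dominating_perms :: "nat \<Rightarrow> (nat \<Rightarrow> nat) set" where
  "dominating_perms r = {p. p permutes {1..r} \<and> p r = r \<and>
     (\<forall>k\<in>{1..r}. (\<Sum>j = 1..k. r - j) \<le> (\<Sum>j = 1..k. shifted_coord r (p j)))}"

text \<open>
  The labels, in the order of their positions, of the coordinates that p puts in the positions 2,
  ..., r - 1.
\<close>

definition label_list :: "nat \<Rightarrow> (nat \<Rightarrow> nat) \<Rightarrow> nat list" where
  "label_list r p = map (\<lambda>j. r - p j) [2..<r]"

text \<open>
  Only the coordinate r reaches the first coordinate r - 1 of rho.
\<close>

lemma dominating_perms_fix_1:
  assumes "r \<ge> 4" "p \<in> dominating_perms r"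
  shows "p 1 = 1"
proof (rule ccontr)
  assume ne: "p 1 \<noteq> 1"
  have p: "p permutes {1..r}" and "\<forall>k\<in>{1..r}. (\<Sum>j = 1..k. r - j) \<le> (\<Sum>j = 1..k. shifted_coord r (p j))"
    using assms(2) by (auto simp: dominating_perms_def)
  then have "r - 1 \<le> shifted_coord r (p 1)"
    using assms(1) by (force dest: bspec[of _ _ 1])
  moreover have "p 1 \<in> {1..r}"
    using assms(1) permutes_in_image[OF p, of 1] by simp
  ultimately show False
    using ne assms(1) by (auto simp: shifted_coord_def split: if_splits)
qed

lemma dominating_label_list_iff:
  assumes r: "r \<ge> 4" and p: "p permutes {1..r}" and fix_ends: "p 1 = 1" "p r = r"
  shows "dominating 1 (label_list r p) \<longleftrightarrow>
    (\<forall>k\<in>{1..r}. (\<Sum>j = 1..k. r - j) \<le> (\<Sum>j = 1..k. shifted_coord r (p j)))" (is "_ \<longleftrightarrow> (\<forall>k\<in>_. ?P k)")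
proof -
  have inner: "p j \<in> {2..<r}" if "j \<in> {2..<r}" for j
  proof -
    have "p j \<in> {1..r}"
      using that permutes_in_image[OF p, of j] by auto
    moreover have "p j \<noteq> p 1" "p j \<noteq> p r"
      using that permutes_inj[OF p] by (auto simp: inj_eq)
    ultimately show ?thesis
      using fix_ends by auto
  qed
  have coord: "shifted_coord r j = max 2 (r - j)" if "j \<in> {2..<r}" for j
    using that r by (auto simp: shifted_coord_def)
  have shift: "(\<Sum>j = 1..Suc k. f j) = f 1 + (\<Sum>i<k. f (i + 2))" for f :: "nat \<Rightarrow> nat" and k
    by (induction k) auto
  have P: "?P (Suc k) \<longleftrightarrow> (\<Sum>i<k. r - 2 - i) \<le> 1 + (\<Sum>i<k. max 2 (label_list r p ! i))" if "k \<le> r - 2" for k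
  proof -
    have "(\<Sum>i<k. shifted_coord r (p (i + 2))) = (\<Sum>i<k. max 2 (label_list r p ! i))"
    proof (rule sum.cong)
      fix i assume "i \<in> {..<k}"
      then have i: "i < r - 2" "i + 2 \<in> {2..<r}"
        using that by auto
      show "shifted_coord r (p (i + 2)) = max 2 (label_list r p ! i)"
        using coord[OF inner[OF i(2)]] i by (simp add: label_list_def add.commute)
    qed simp
    moreover have "shifted_coord r (p 1) = r"
      using r fix_ends by (simp add: shifted_coord_def)
    moreover have "(\<Sum>i<k. r - (i + 2)) = (\<Sum>i<k. r - 2 - i)"
      by (intro sum.cong) auto
    ultimately show ?thesis
      unfolding shift using r by (intro iffI; linarith)
  qed
  have last: "?P r" if "?P (r - 1)"
  proof -
    have "(\<Sum>j = 1..r. f j) = (\<Sum>j = 1..r - 1. f j) + f r" for f :: "nat \<Rightarrow> nat"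
      using r by (cases r) auto
    then show ?thesis
      using that by simp
  qed
  have "(\<forall>k\<in>{1..r}. ?P k) \<longleftrightarrow> (\<forall>k\<le>r - 2. ?P (Suc k))"
  proof
    assume "\<forall>k\<in>{1..r}. ?P k"
    moreover have "Suc k \<in> {1..r}" if "k \<le> r - 2" for k
      using that r by auto
    ultimately show "\<forall>k\<le>r - 2. ?P (Suc k)"
      by blast
  next
    assume *: "\<forall>k\<le>r - 2. ?P (Suc k)"
    have upto: "?P k" if "k \<in> {1..r - 1}" for k
    proof -
      have "k - 1 \<le> r - 2" "Suc (k - 1) = k"
        using that by auto
      then show ?thesis
        using * by metis
    qed
    show "\<forall>k\<in>{1..r}. ?P k"
    proof
      fix k assume "k \<in> {1..r}"
      then show "?P k"
        using upto[of k] last upto[of "r - 1"] r by (cases "k = r") auto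
    qed
  qed
  also have "\<dots> \<longleftrightarrow> (\<forall>k\<le>r - 2. (\<Sum>i<k. r - 2 - i) \<le> 1 + (\<Sum>i<k. max 2 (label_list r p ! i)))"
    using P by blast
  also have "\<dots> \<longleftrightarrow> dominating 1 (label_list r p)"
    by (simp add: dominating_iff label_list_def)
  finally show ?thesis ..
qed

lemma bij_label_list:
  assumes r: "r \<ge> 4"
  shows "bij_betw (label_list r) (dominating_perms r) (dominating_orderings (r - 2))"
proof (rule bij_betw_imageI)
  show "inj_on (label_list r) (dominating_perms r)"
  proof (rule inj_onI, rule ext)
    fix p q j assume pq: "p \<in> dominating_perms r" "q \<in> dominating_perms r" and eq: "label_list r p = label_list r q"
    have p: "p permutes {1..r}" "p r = r" "p 1 = 1" and q: "q permutes {1..r}" "q r = r" "q 1 = 1"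
      using pq dominating_perms_fix_1[OF r] by (auto simp: dominating_perms_def)
    consider "j = 1" | "j = r" | "j \<notin> {1..r}" | "j \<in> {2..<r}"
      by fastforce
    then show "p j = q j"
    proof cases
      case 4
      then have "r - p j = r - q j"
        using eq by (auto simp: label_list_def)
      moreover have "p j \<in> {1..r}" "q j \<in> {1..r}"
        using 4 permutes_in_image[OF p(1), of j] permutes_in_image[OF q(1), of j] by auto
      ultimately show ?thesis by auto
    qed (use p q in \<open>auto simp: permutes_not_in\<close>)
  qed
next
  show "label_list r ` dominating_perms r = dominating_orderings (r - 2)"
  proof (intro equalityI subsetI)
    fix xs assume "xs \<in> label_list r ` dominating_perms r"
    then obtain p where pd: "p \<in> dominating_perms r" and xs: "xs = label_list r p"
      by blast
    have p: "p permutes {1..r}" "p r = r" "p 1 = 1"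
      using pd dominating_perms_fix_1[OF r] by (auto simp: dominating_perms_def)
    have le: "p j \<le> r" if "j \<in> {2..<r}" for j
      using that permutes_in_image[OF p(1), of j] by auto
    have "inj_on (\<lambda>j. r - p j) {2..<r}"
    proof (rule inj_onI)
      fix i j assume *: "i \<in> {2..<r}" "j \<in> {2..<r}" "r - p i = r - p j"
      then have "p i = p j"
        using le[OF *(1)] le[OF *(2)] by simp
      then show "i = j"
        using permutes_inj[OF p(1)] by (simp add: inj_eq)
    qed
    then have dist: "distinct xs"
      by (simp add: xs label_list_def distinct_map)
    have "{2..<r} = {1..r} - {1, r}"
      by auto
    then have "p ` {2..<r} = p ` {1..r} - p ` {1, r}"
      using image_set_diff[OF permutes_inj[OF p(1)]] by simp
    also have "\<dots> = {2..<r}"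
      using permutes_image[OF p(1)] p by auto
    finally have "set xs = (\<lambda>j. r - j) ` {2..<r}"
      unfolding xs label_list_def by (simp flip: image_image[of "\<lambda>j. r - j" p])
    also have "\<dots> = {1..r - 2}"
    proof
      show "{1..r - 2} \<subseteq> (\<lambda>j. r - j) ` {2..<r}"
      proof
        fix x assume "x \<in> {1..r - 2}"
        then have "x = r - (r - x)" "r - x \<in> {2..<r}"
          by auto
        then show "x \<in> (\<lambda>j. r - j) ` {2..<r}"
          by blast
      qed
    qed auto
    finally show "xs \<in> dominating_orderings (r - 2)"
      using dist pd dominating_label_list_iff[OF r p(1) p(3) p(2)]
      by (auto simp: dominating_orderings_def dominating_perms_def xs)
  next
    fix xs assume "xs \<in> dominating_orderings (r - 2)"
    then have xs: "distinct xs" "set xs = {1..r - 2}" "dominating 1 xs"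
      by (auto simp: dominating_orderings_def)
    have len: "length xs = r - 2"
      using length_ordering xs by blast
    define p where "p j = (if j \<in> {2..<r} then r - xs ! (j - 2) else j)" for j
    have nth: "xs ! (j - 2) \<in> {1..r - 2}" if "j \<in> {2..<r}" for j
      using that nth_mem[of "j - 2" xs] xs(2) len by auto
    have maps: "p ` {2..<r} \<subseteq> {2..<r}"
    proof (rule image_subsetI)
      fix j assume j: "j \<in> {2..<r}"
      then show "p j \<in> {2..<r}"
        using nth[OF j] by (auto simp: p_def)
    qed
    have inj: "inj_on p {2..<r}"
    proof (rule inj_onI)
      fix i j assume *: "i \<in> {2..<r}" "j \<in> {2..<r}" "p i = p j"
      then have "r - xs ! (i - 2) = r - xs ! (j - 2)"
        by (simp add: p_def)
      moreover have "xs ! (i - 2) \<le> r" "xs ! (j - 2) \<le> r"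
        using nth[OF *(1)] nth[OF *(2)] by auto
      ultimately have "xs ! (i - 2) = xs ! (j - 2)"
        by linarith
      then show "i = j"
        using * xs(1) len by (auto simp: nth_eq_iff_index_eq)
    qed
    have "p permutes {2..<r}"
      using inj endo_inj_surj[OF _ maps inj]
      by (intro bij_imp_permutes) (auto simp: bij_betw_def p_def)
    then have p: "p permutes {1..r}"
      by (rule permutes_subset) auto
    have ends: "p 1 = 1" "p r = r"
      by (auto simp: p_def)
    have "label_list r p = xs"
    proof (rule nth_equalityI)
      fix i assume "i < length (label_list r p)"
      then have i: "i < r - 2" "i + 2 \<in> {2..<r}"
        by (auto simp: label_list_def)
      then show "label_list r p ! i = xs ! i"
        using nth[OF i(2)] by (auto simp: label_list_def p_def)
    qed (simp add: label_list_def len)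
    moreover have "p \<in> dominating_perms r"
      using dominating_label_list_iff[OF r p ends] xs(3) p ends calculation
      by (simp add: dominating_perms_def)
    ultimately show "xs \<in> label_list r ` dominating_perms r"
      by blast
  qed
qed

lemma card_dominating_perms:
  assumes "r \<ge> 4"
  shows "card (dominating_perms r) = fib_tilde (r - 3)"
proof -
  have "card (dominating_perms r) = card (dominating_orderings (r - 3 + 1))"
  proof -
    have "r - 3 + 1 = r - 2"
      using assms by simp
    then show ?thesis
      using bij_betw_same_card[OF bij_label_list[OF assms]] by (simp only:)
  qed
  then show ?thesis
    using card_dominating_orderings[of "r - 3"] assms by simp
qed

section \<open>Positivity of the partition function\<close>

lemma functional_sum_mset_ge:
  fixes f :: "weight \<Rightarrow> real"
  assumes "f 0 = 0" "\<And>a b. f (a + b) = f a + f b" "\<And>a. a \<in> S \<Longrightarrow> c \<le> f a"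
    and "set_mset M \<subseteq> S"
  shows "c * size M \<le> f (\<Sum>\<^sub># M)"
  using assms(4)
proof (induction M)
  case (add a M)
  then have "c * size M \<le> f (\<Sum>\<^sub># M)" "c \<le> f a"
    using assms(3)[of a] by auto
  moreover have "c * size (add_mset a M) = c + c * size M"
    by (simp add: algebra_simps)
  moreover have "f (\<Sum>\<^sub># (add_mset a M)) = f a + f (\<Sum>\<^sub># M)"
    by (simp only: sum_mset.add_mset assms(2))
  ultimately show ?case
    by linarith
qed (use assms(1) in simp)

lemma positive_root_height:
  assumes "r \<ge> 2" "a \<in> positive_roots r"
  shows "1 \<le> Re (height r a)"
proof -
  obtain M where M: "a \<in> roots r" "set_mset M \<subseteq> simple_root r ` {1..r}" "a = \<Sum>\<^sub># M"
    using assms(2) unfolding positive_roots_def by blast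
  then have "M \<noteq> {#}"
    by (auto simp: roots_def)
  then have "1 \<le> size M"
    using nonempty_has_size[of M] by simp
  then show ?thesis
    using height_sum_simple_roots[OF assms(1) M(2)] M(3) by simp
qed

text \<open>
  The height bounds the number of positive roots in a partition.
\<close>

lemma finite_partitions:
  assumes "r \<ge> 2"
  shows "finite {M. set_mset M \<subseteq> positive_roots r \<and> \<Sum>\<^sub># M = \<xi>}" (is "finite ?P")
proof (rule finite_subset)
  let ?N = "nat \<lceil>Re (height r \<xi>)\<rceil>"
  show "?P \<subseteq> (\<Union>n\<le>?N. multisets_of_size (positive_roots r) n)"
  proof
    fix M assume "M \<in> ?P"
    then have M: "set_mset M \<subseteq> positive_roots r" "\<Sum>\<^sub># M = \<xi>"
      by auto
    have "1 * real (size M) \<le> Re (height r (\<Sum>\<^sub># M))"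
      using positive_root_height[OF assms] M(1)
      by (intro functional_sum_mset_ge[where f = "\<lambda>a. Re (height r a)" and S = "positive_roots r"]) auto
    then have "real (size M) \<le> Re (height r \<xi>)"
      unfolding M(2) by simp
    then have "size M \<le> ?N"
      by linarith
    then show "M \<in> (\<Union>n\<le>?N. multisets_of_size (positive_roots r) n)"
      using M(1) by (auto simp: multisets_of_size_def)
  qed
  show "finite (\<Union>n\<le>?N. multisets_of_size (positive_roots r) n)"
    using finite_positive_roots[OF assms] by auto
qed

lemma kostant_partition_pos_iff:
  assumes "r \<ge> 2"
  shows "kostant_partition r \<xi> > 0 \<longleftrightarrow> \<xi> \<in> nonneg_span (positive_roots r)"
  using finite_partitions[OF assms, of \<xi>]
  by (auto simp: kostant_partition_def nonneg_span_def card_gt_0_iff)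

lemma simple_roots_positive:
  assumes "r \<ge> 2"
  shows "simple_root r ` {1..r} \<subseteq> positive_roots r"
proof
  fix a assume "a \<in> simple_root r ` {1..r}"
  then obtain i where i: "i \<in> {1..r}" "a = simple_root r i"
    by blast
  show "a \<in> positive_roots r"
  proof (cases "i < r")
    case True
    then have "a = (\<lambda>(i, j). eps i - eps j) (i, i + 1)" "(i, i + 1) \<in> index_pairs r"
      using i by (auto simp: simple_root_def index_pairs_def)
    then show ?thesis
      unfolding positive_roots_eq[OF assms] by blast
  next
    case False
    then have "a = (\<lambda>(i, j). eps i + eps j) (r - 1, r)" "(r - 1, r) \<in> index_pairs r"
      using i assms by (auto simp: simple_root_def index_pairs_def)
    then show ?thesis
      unfolding positive_roots_eq[OF assms] by blast
  qed
qed

lemma nonneg_span_mono: "S \<subseteq> T \<Longrightarrow> nonneg_span S \<subseteq> nonneg_span T"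
  unfolding nonneg_span_def by blast

lemma sum_eps: "(\<Sum>j = Suc 0..k. eps i j) = (if i \<in> {Suc 0..k} then 1 else 0)"
  by (simp add: eps_def)

text \<open>
  For k at most r - 2 the partial sum is the coefficient of the simple root with index k, and for
  k = r it is twice the coefficient of the last one. The next lemma treats twice the coefficient
  of the simple root with index r - 1.
\<close>

lemma partial_sum_nonneg:
  assumes r: "r \<ge> 2" and "\<xi> \<in> nonneg_span (positive_roots r)"
  shows "0 \<le> Re (\<Sum>j = 1..k. \<xi> j)"
proof -
  obtain M where M: "set_mset M \<subseteq> positive_roots r" "\<xi> = \<Sum>\<^sub># M"
    using assms(2) unfolding nonneg_span_def by blast
  have "0 * real (size M) \<le> Re (\<Sum>j = 1..k. (\<Sum>\<^sub># M) j)"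
  proof (rule functional_sum_mset_ge[where f = "\<lambda>a. Re (\<Sum>j = 1..k. a j)", OF _ _ _ M(1)])
    fix a assume "a \<in> positive_roots r"
    then obtain i j where "1 \<le> i" "i < j" "a = eps i + eps j \<or> a = eps i - eps j"
      unfolding positive_roots_eq[OF r] index_pairs_def by auto
    then show "0 \<le> Re (\<Sum>j = 1..k. a j)"
      by (auto simp: sum.distrib sum_subtractf sum_eps simp del: Re_sum)
  qed (simp_all add: sum.distrib)
  then show ?thesis
    unfolding M(2) by simp
qed

lemma total_minus_twice_last_nonneg:
  assumes r: "r \<ge> 2" and "\<xi> \<in> nonneg_span (positive_roots r)"
  shows "0 \<le> Re ((\<Sum>j = 1..r. \<xi> j) - 2 * \<xi> r)"
proof -
  obtain M where M: "set_mset M \<subseteq> positive_roots r" "\<xi> = \<Sum>\<^sub># M"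
    using assms(2) unfolding nonneg_span_def by blast
  have "0 * real (size M) \<le> Re ((\<Sum>j = 1..r. (\<Sum>\<^sub># M) j) - 2 * (\<Sum>\<^sub># M) r)"
  proof (rule functional_sum_mset_ge[where f = "\<lambda>a. Re ((\<Sum>j = 1..r. a j) - 2 * a r)", OF _ _ _ M(1)])
    fix a assume "a \<in> positive_roots r"
    then obtain i j where "1 \<le> i" "i < j" "j \<le> r" "a = eps i + eps j \<or> a = eps i - eps j"
      unfolding positive_roots_eq[OF r] index_pairs_def by auto
    then show "0 \<le> Re ((\<Sum>j = 1..r. a j) - 2 * a r)"
      by (auto simp: sum.distrib sum_subtractf sum_eps simp del: Re_sum) (auto simp: eps_def)
  qed (simp_all add: sum.distrib algebra_simps)
  then show ?thesis
    unfolding M(2) by simp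
qed

text \<open>
  The coefficients are the partial sums c k for the indices k at most r - 2, and 1 for both of the
  indices r - 1 and r, since the last coordinate is 0 and the total is 2.
\<close>

lemma in_simple_span:
  assumes r: "r \<ge> 2" and supp: "\<And>k. k \<notin> {1..<r} \<Longrightarrow> \<xi> k = 0"
    and c: "\<And>k. k \<le> r - 2 \<Longrightarrow> (\<Sum>j = 1..k. \<xi> j) = of_nat (c k)" and total: "(\<Sum>j = 1..r - 1. \<xi> j) = 2"
  shows "\<xi> \<in> nonneg_span (simple_root r ` {1..r})"
proof -
  define d where "d k = (if k \<le> r - 2 then c k else 1)" for k
  have d_last: "d (r - 1) = 1" "d r = 1"
    using r by (auto simp: d_def)
  have "\<xi> = (\<Sum>i = 1..r. (\<lambda>k. of_nat (d i) * simple_root r i k))"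
  proof
    fix k
    have "{1..r} = insert r {1..<r}"
      using r by auto
    then have "(\<Sum>i = 1..r. (\<lambda>k. of_nat (d i) * simple_root r i k)) k
        = of_nat (d r) * simple_root r r k + (\<Sum>i = 1..<r. of_nat (d i) * simple_root r i k)"
      by (simp add: sum_apply)
    also have "(\<Sum>i = 1..<r. of_nat (d i) * simple_root r i k)
        = (\<Sum>i = 1..<r. (if i = k then of_nat (d k) else 0) - (if i = k - 1 then of_nat (d (k - 1)) else 0))"
      by (intro sum.cong) (auto simp: simple_root_def eps_def)
    also have "\<dots> = (if k \<in> {1..<r} then of_nat (d k) else 0)
        - (if k - 1 \<in> {1..<r} then of_nat (d (k - 1)) else 0)"
      by (simp add: sum_subtractf)
    also have "of_nat (d r) * simple_root r r k = (if k \<in> {r - 1, r} then 1 else 0)"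
      using r by (auto simp: simple_root_def eps_def d_last)
    finally have eq: "(\<Sum>i = 1..r. (\<lambda>k. of_nat (d i) * simple_root r i k)) k
        = (if k \<in> {r - 1, r} then 1 else 0) + ((if k \<in> {1..<r} then of_nat (d k) else 0)
          - (if k - 1 \<in> {1..<r} then of_nat (d (k - 1)) else 0))" .
    have step: "(\<Sum>j = 1..k. \<xi> j) = (\<Sum>j = 1..k - 1. \<xi> j) + \<xi> k" if "k \<ge> 1"
      using that by (cases k) auto
    consider "k = 0" | "1 \<le> k" "k \<le> r - 2" | "k = r - 1" | "k = r" | "k > r"
      using r by linarith
    then show "\<xi> k = (\<Sum>i = 1..r. (\<lambda>k. of_nat (d i) * simple_root r i k)) k"
    proof cases
      case 1
      then show ?thesis
        unfolding eq using supp[of k] r by auto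
    next
      case 2
      have "c (k - 1) = 0" if "k = 1"
        using c[of "k - 1"] 2 that by simp
      moreover have "\<xi> k = of_nat (c k) - of_nat (c (k - 1))"
      proof -
        have "(\<Sum>j = 1..k - 1. \<xi> j) = of_nat (c (k - 1))"
          by (rule c) (use 2 in simp)
        then show ?thesis
          using step[OF 2(1)] c[OF 2(2)] by (metis add_diff_cancel_left')
      qed
      ultimately show ?thesis
        unfolding eq using 2 by (auto simp: d_def)
    next
      case 3
      then have k1: "k - 1 = r - 2"
        by simp
      have "c (r - 2) = 0" if "r = 2"
        using c[of "r - 2"] that by simp
      moreover have "\<xi> k = 2 - of_nat (c (r - 2))"
      proof -
        have "(\<Sum>j = 1..k - 1. \<xi> j) = of_nat (c (r - 2))"
          unfolding k1 by (rule c) simp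
        moreover have "(\<Sum>j = 1..k. \<xi> j) = 2"
          unfolding 3 by (rule total)
        moreover have "k \<ge> 1"
          using 3 r by simp
        ultimately show ?thesis
          using step by (metis add_diff_cancel_left')
      qed
      ultimately show ?thesis
        unfolding eq k1 using 3 r d_last by (auto simp: d_def)
    next
      case 4
      then show ?thesis
        unfolding eq using supp[of k] r d_last by auto
    next
      case 5
      then show ?thesis
        unfolding eq using supp[of k] by auto
    qed
  qed
  moreover have "(\<Sum>i = 1..r. (\<lambda>k. of_nat (d i) * simple_root r i k)) \<in> nonneg_span (simple_root r ` {1..r})"
    by (intro nonneg_span_sum nonneg_span_scale nonneg_span_base) auto
  ultimately show ?thesis
    by simp
qed

section \<open>The Weyl alternation set\<close>

lemma sum_simple_roots:
  assumes "r \<ge> 2"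
  shows "(\<Sum>i = 1..r. simple_root r i) = eps 1 + eps (r - 1)"
proof -
  have "{1..r} = insert r {1..<r}"
    using assms by auto
  then have "(\<Sum>i = 1..r. simple_root r i) = simple_root r r + (\<Sum>i = 1..<r. simple_root r i)"
    by simp
  also have "(\<Sum>i = 1..<r. simple_root r i) = (\<Sum>i = 1..<r. (- eps (Suc i)) - (- eps i))"
    by (intro sum.cong) (auto simp: simple_root_def)
  also have "\<dots> = (- eps r) - (- eps 1)"
    using assms by (intro sum_Suc_diff') auto
  also have "simple_root r r + (- eps r - (- eps 1)) = eps 1 + eps (r - 1)"
    by (simp add: simple_root_def algebra_simps)
  finally show ?thesis .
qed

lemma shifted_weight:
  assumes "r \<ge> 2"
  shows "(\<Sum>i = 1..r. simple_root r i) + rho r = (\<lambda>k. of_nat (shifted_coord r k))"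
  unfolding sum_simple_roots[OF assms]
  by (rule ext) (auto simp: rho_eq[OF assms] shifted_coord_def eps_def)

lemma sum_shifted_coord:
  assumes "r \<ge> 2"
  shows "(\<Sum>k = 1..r. shifted_coord r k) = (\<Sum>k = 1..r. r - k) + 2"
proof -
  have "(\<Sum>k = 1..r. shifted_coord r k) = (\<Sum>k = 1..r. (r - k) + ((if k = 1 then 1 else 0)
      + (if k = r - 1 then 1 else 0)))"
    by (intro sum.cong) (auto simp: shifted_coord_def)
  also have "\<dots> = (\<Sum>k = 1..r. r - k) + ((\<Sum>k = 1..r. if k = 1 then 1 else 0)
      + (\<Sum>k = 1..r. if k = r - 1 then 1 else 0))"
    unfolding sum.distrib ..
  also have "\<dots> = (\<Sum>k = 1..r. r - k) + 2"
    using assms by simp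
  finally show ?thesis .
qed

lemma shifted_coord_ge_2:
  assumes "r \<ge> 3" "k \<in> {1..<r}"
  shows "2 \<le> shifted_coord r k"
  using assms by (auto simp: shifted_coord_def)

text \<open>
  The coordinates of the shifted weight have total only 2 more than those of rho, so no coordinate
  of value at least 2 changes sign. The parity of the sign changes then protects the coordinate 0
  as well.
\<close>

lemma signed_permutation_dominating:
  assumes r: "r \<ge> 3" and p: "p permutes {1..r}" and s: "\<And>k. s k = 1 \<or> s k = -1"
    and supp: "\<And>k. k \<notin> {1..r} \<Longrightarrow> s k = 1" and ps: "(\<Prod>k = 1..r. s k) = 1"
    and span: "(\<lambda>k. s k * of_nat (shifted_coord r (p k))) - rho r \<in> nonneg_span (positive_roots r)"
  shows "s = (\<lambda>_. 1 :: complex)" "p \<in> dominating_perms r"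
proof -
  let ?y = "shifted_coord r"
  let ?\<xi> = "(\<lambda>k. s k * of_nat (?y (p k))) - rho r"
  have r2: "r \<ge> 2"
    using r by simp
  have psum: "Re (\<Sum>j = 1..k. ?\<xi> j) = (\<Sum>j = 1..k. Re (s j) * ?y (p j)) - real (\<Sum>j = 1..k. r - j)" for k
    by (simp add: rho_eq[OF r2] sum_subtractf)
  have total: "(\<Sum>j = 1..r. ?y (p j)) = (\<Sum>j = 1..r. r - j) + 2"
    using sum.permute[OF p, of ?y] sum_shifted_coord[OF r2] by (simp add: o_def)
  have "(\<Sum>j = 1..r. (1 - Re (s j)) * ?y (p j)) = real (\<Sum>j = 1..r. ?y (p j)) - (\<Sum>j = 1..r. Re (s j) * ?y (p j))"
    by (simp add: sum_subtractf left_diff_distrib)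
  then have small: "(\<Sum>j = 1..r. (1 - Re (s j)) * ?y (p j)) \<le> 2"
    using partial_sum_nonneg[OF r2 span, of r] unfolding psum total by simp
  have s_one: "s k = 1" if k: "k \<in> {1..r}" "p k \<noteq> r" for k
  proof (rule ccontr)
    assume "s k \<noteq> 1"
    then have "s k = -1"
      using s by blast
    have "p k \<in> {1..<r}"
      using k permutes_in_image[OF p, of k] by auto
    then have "4 \<le> (1 - Re (s k)) * ?y (p k)"
      using shifted_coord_ge_2[OF r, of "p k"] \<open>s k = -1\<close> by simp
    also have "\<dots> \<le> (\<Sum>j = 1..r. (1 - Re (s j)) * ?y (p j))"
    proof (rule member_le_sum[of k "{1..r}" "\<lambda>j. (1 - Re (s j)) * ?y (p j)"])
      fix j
      show "0 \<le> (1 - Re (s j)) * ?y (p j)"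
        using s[of j] by auto
    qed (use k in auto)
    finally show False
      using small by simp
  qed
  \<comment> \<open>The position m of the coordinate 0 is the only one whose sign is still open.\<close>
  obtain m where m: "p m = r"
    using permutes_surj[OF p] by (metis surjD)
  have m_in: "m \<in> {1..r}"
    using permutes_in_image[OF p, of m] m r by simp
  have "p k \<noteq> r" if "k \<noteq> m" for k
    using that m permutes_inj[OF p] by (metis injD)
  then have "(\<Prod>k\<in>{1..r} - {m}. s k) = 1"
    by (intro prod.neutral ballI s_one) auto
  then have "s m = 1"
    using ps prod.remove[OF _ m_in, of s] by simp
  then have s1: "s k = 1" for k
    using s_one[of k] supp[of k] m permutes_inj[OF p] by (metis injD)
  then show "s = (\<lambda>_. 1)"
    by auto
  \<comment> \<open>This forces the last coordinate to be at most 1, hence 0.\<close>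
  have "0 \<le> Re ((\<Sum>j = 1..r. ?\<xi> j) - 2 * ?\<xi> r)"
    by (rule total_minus_twice_last_nonneg[OF r2 span])
  also have "Re ((\<Sum>j = 1..r. ?\<xi> j) - 2 * ?\<xi> r) = Re (\<Sum>j = 1..r. ?\<xi> j) - 2 * Re (?\<xi> r)"
    by simp
  also have "Re (\<Sum>j = 1..r. ?\<xi> j) = real (\<Sum>j = 1..r. ?y (p j)) - real (\<Sum>j = 1..r. r - j)"
    unfolding psum[of r] unfolding s1 by simp
  also have "\<dots> = 2"
    unfolding total by simp
  also have "Re (?\<xi> r) = ?y (p r)"
    using r by (simp add: s1 rho_eq[OF r2])
  finally have "?y (p r) \<le> 1"
    by simp
  moreover have "p r \<in> {1..r}"
    using permutes_in_image[OF p, of r] r by simp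
  ultimately have "p r = r"
    using shifted_coord_ge_2[OF r, of "p r"] by fastforce
  moreover have "(\<Sum>j = 1..k. r - j) \<le> (\<Sum>j = 1..k. ?y (p j))" for k
  proof -
    have "0 \<le> real (\<Sum>j = 1..k. ?y (p j)) - real (\<Sum>j = 1..k. r - j)"
      using partial_sum_nonneg[OF r2 span, of k] unfolding psum[of k] unfolding s1 by simp
    then show ?thesis
      by linarith
  qed
  ultimately show "p \<in> dominating_perms r"
    using p by (simp add: dominating_perms_def)
qed

lemma dominating_in_span:
  assumes r: "r \<ge> 3" and "p \<in> dominating_perms r"
  shows "(\<lambda>k. of_nat (shifted_coord r (p k))) - rho r \<in> nonneg_span (simple_root r ` {1..r})"
proof -
  let ?y = "shifted_coord r"
  let ?\<xi> = "(\<lambda>k. of_nat (?y (p k))) - rho r"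
  have r2: "r \<ge> 2"
    using r by simp
  have p: "p permutes {1..r}" "p r = r"
    and dom: "\<And>k. k \<in> {1..r} \<Longrightarrow> (\<Sum>j = 1..k. r - j) \<le> (\<Sum>j = 1..k. ?y (p j))"
    using assms(2) by (auto simp: dominating_perms_def)
  have psum: "(\<Sum>j = 1..k. ?\<xi> j) = of_nat (\<Sum>j = 1..k. ?y (p j)) - of_nat (\<Sum>j = 1..k. r - j)" for k
    by (simp add: rho_eq[OF r2] sum_subtractf)
  show ?thesis
  proof (rule in_simple_span[OF r2])
    fix k assume "k \<notin> {1..<r}"
    then consider "k = r" | "k \<notin> {1..r}"
      by fastforce
    then show "?\<xi> k = 0"
    proof cases
      case 1
      then show ?thesis
        using p r by (simp add: rho_eq[OF r2] shifted_coord_def)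
    next
      case 2
      then show ?thesis
        using permutes_not_in[OF p(1), of k] r by (auto simp: rho_eq[OF r2] shifted_coord_def)
    qed
  next
    fix k assume k: "k \<le> r - 2"
    have "(\<Sum>j = 1..k. r - j) \<le> (\<Sum>j = 1..k. ?y (p j))"
      using dom[of k] k by (cases "k = 0") auto
    then show "(\<Sum>j = 1..k. ?\<xi> j) = of_nat ((\<Sum>j = 1..k. ?y (p j)) - (\<Sum>j = 1..k. r - j))"
      unfolding psum by (rule of_nat_diff[symmetric])
  next
    have "(\<Sum>j = 1..r. ?y (p j)) = (\<Sum>j = 1..r. r - j) + 2"
      using sum.permute[OF p(1), of ?y] sum_shifted_coord[OF r2] by (simp add: o_def)
    moreover have "(\<Sum>j = 1..r. f j) = (\<Sum>j = 1..r - 1. f j) + f r" for f :: "nat \<Rightarrow> nat"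
      using r by (cases r) auto
    moreover have "?y (p r) = 0"
      using p(2) r by (simp add: shifted_coord_def)
    ultimately have "(\<Sum>j = 1..r - 1. ?y (p j)) = (\<Sum>j = 1..r - 1. r - j) + 2"
      by simp
    then show "(\<Sum>j = 1..r - 1. ?\<xi> j) = 2"
      unfolding psum by simp
  qed
qed

lemma weyl_alternation_set_eq:
  assumes r: "r \<ge> 3"
  shows "weyl_alternation_set r (\<Sum>i = 1..r. simple_root r i) 0 = (\<lambda>p v. v \<circ> p) ` dominating_perms r"
proof -
  have r2: "r \<ge> 2"
    using r by simp
  let ?x = "\<lambda>k. of_nat (shifted_coord r k) :: complex"
  have mem: "w \<in> weyl_alternation_set r (\<Sum>i = 1..r. simple_root r i) 0 \<longleftrightarrow>
      w \<in> weyl_group r \<and> w ?x - rho r \<in> nonneg_span (positive_roots r)" for w :: "weight \<Rightarrow> weight"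
    unfolding weyl_alternation_set_def
    by (simp only: mem_Collect_eq kostant_partition_pos_iff[OF r2] shifted_weight[OF r2] add_0_left)
  show ?thesis
  proof (intro equalityI subsetI)
    fix w assume "w \<in> weyl_alternation_set r (\<Sum>i = 1..r. simple_root r i) 0"
    then have w: "w \<in> weyl_group r" and span: "w ?x - rho r \<in> nonneg_span (positive_roots r)"
      unfolding mem by auto
    obtain s p where p: "p permutes {1..r}" and s: "\<And>k. s k = 1 \<or> s k = -1"
        "\<And>k. k \<notin> {1..r} \<Longrightarrow> s k = 1" "(\<Prod>k = 1..r. s k) = 1" and w_eq: "w = (\<lambda>v k. s k * v (p k))"
      using weyl_group_signed_permutation[OF r2 w] by blast
    have "s = (\<lambda>_. 1)" "p \<in> dominating_perms r"
      using signed_permutation_dominating[OF r p s] span[unfolded w_eq] by blast+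
    moreover have "w = (\<lambda>v. v \<circ> p)"
      by (simp add: w_eq calculation(1) fun_eq_iff)
    ultimately show "w \<in> (\<lambda>p v. v \<circ> p) ` dominating_perms r"
      by blast
  next
    fix w :: "weight \<Rightarrow> weight" assume "w \<in> (\<lambda>p v. v \<circ> p) ` dominating_perms r"
    then obtain p where p: "p \<in> dominating_perms r" and w: "w = (\<lambda>v :: weight. v \<circ> p)"
      by blast
    have "w \<in> weyl_group r"
      unfolding w using p by (intro weyl_group_permutation) (simp add: dominating_perms_def)
    moreover have "w ?x - rho r \<in> nonneg_span (positive_roots r)"
      using dominating_in_span[OF r p] nonneg_span_mono[OF simple_roots_positive[OF r2]]
      by (auto simp: w o_def)
    ultimately show "w \<in> weyl_alternation_set r (\<Sum>i = 1..r. simple_root r i) 0"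
      unfolding mem by blast
  qed
qed

lemma inj_permutation_action: "inj (\<lambda>(p :: nat \<Rightarrow> nat) (v :: weight). v \<circ> p)"
proof (rule injI, rule ext)
  fix p q :: "nat \<Rightarrow> nat" and k
  assume "(\<lambda>v :: weight. v \<circ> p) = (\<lambda>v. v \<circ> q)"
  \<comment> \<open>Evaluation at the weight with the pairwise different coordinates 0, 1, 2, ...\<close>
  then have "(of_nat \<circ> p) k = ((of_nat :: nat \<Rightarrow> complex) \<circ> q) k"
    by metis
  then show "p k = q k"
    by simp
qed

theorem theorem3p13:
  fixes r :: nat
  assumes "r \<ge> 4"
  shows "card (weyl_alternation_set r (\<Sum>i = 1..r. simple_root r i) 0) = fib_tilde (r - 3)"
proof -
  have "card (weyl_alternation_set r (\<Sum>i = 1..r. simple_root r i) 0) = card (dominating_perms r)"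
    using assms by (subst weyl_alternation_set_eq)
      (auto intro!: card_image inj_on_subset[OF inj_permutation_action])
  then show ?thesis
    using card_dominating_perms[OF assms] by simp
qed

end
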